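(* Let $V\in\mathbb{R}^{n\times p}$ have full column rank $p<n$, let $A\in\mathbb{R}^{n\times n}$ be symmetric of full rank $n$, such that $A+\varepsilon^{-1}VV^\top$ is positive semi-definite for all sufficiently small $\varepsilon>0$. Let $\mathcal{X}_\varepsilon\sim DPP(A+\varepsilon^{-1}VV^\top)$. Then, as $\varepsilon\to0^+$, $\mathcal{X}_\varepsilon$ converges in distribution to a point process $\mathcal{X}_\star\sim DPP(A;V)$.
   Context: All matrices are real. The ground set is $\Omega$, identified with $\{1,\dots,n\}$; a point process is a random subset of $\Omega$. For a matrix $B$ and index set $X$, $B_X$ is the principal submatrix indexed by $X$, and $B_{X,:}$ keeps the rows in $X$ and all columns. The determinant of an empty matrix is $1$. Convergence of point processes on the finite set $\Omega$ means convergence of $\mathbf{P}(\mathcal{X}_\varepsilon=X)$ for every $X\subseteq\Omega$. L-ensemble: for $L\in\mathbb{R}^{n\times n}$ symmetric positive semi-definite, $\mathcal{X}\sim DPP(L)$ means $\mathbf{P}(\mathcal{X}=X)=\det(L_X)/\det(I+L)$ for all $X\subseteq\Omega$. Nonnegative pair (NNP): a pair $(L;V)$ with $L\in\mathbb{R}^{n\times n}$ symmetric, $V\in\mathbb{R}^{n\times p}$ of full column rank, $0\le p\le n$, and $x^\top Lx\ge0$ for all $x$ with $V^\top x=0$. Extended L-ensemble: for an NNP $(L;V)$, $\mathcal{X}\sim DPP(L;V)$ means that for all $X\subseteq\Omega$, $$\mathbf{P}(\mathcal{X}=X)\propto(-1)^p\det\begin{pmatrix}L_X&V_{X,:}\\(V_{X,:})^\top&0\end{pmatrix}.$$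 *)

theory Defs
  imports
    "HOL-Probability.Probability_Measure"
    "Jordan_Normal_Form.DL_Rank"
    "Jordan_Normal_Form.DL_Submatrix"
begin

text \<open>
  HOL-Analysis and Jordan_Normal_Form both provide \<open>det\<close>, \<open>vec\<close> and \<open>mat\<close>; the matrices here are
  those of Jordan_Normal_Form, whose dimensions are natural numbers (possibly 0) and whose indices
  start at 0. The ground set is therefore \<open>{..<n}\<close>.
\<close>

definition symmetric_matrix :: "nat \<Rightarrow> real Matrix.mat \<Rightarrow> bool" where
  "symmetric_matrix n L \<longleftrightarrow> L \<in> carrier_mat n n \<and> transpose_mat L = L"

definition quad_form :: "real Matrix.mat \<Rightarrow> real Matrix.vec \<Rightarrow> real" where
  "quad_form L x = scalar_prod x (mult_mat_vec L x)"

definition pos_semidef :: "nat \<Rightarrow> real Matrix.mat \<Rightarrow> bool" where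
  "pos_semidef n L \<longleftrightarrow>
     symmetric_matrix n L \<and> (\<forall>x\<in>carrier_vec n. 0 \<le> quad_form L x)"

definition full_column_rank :: "nat \<Rightarrow> nat \<Rightarrow> real Matrix.mat \<Rightarrow> bool" where
  "full_column_rank n p V \<longleftrightarrow> V \<in> carrier_mat n p \<and> vec_space.rank n V = p"

definition nonneg_pair :: "nat \<Rightarrow> nat \<Rightarrow> real Matrix.mat \<Rightarrow> real Matrix.mat \<Rightarrow> bool" where
  "nonneg_pair n p L V \<longleftrightarrow>
     symmetric_matrix n L \<and> p \<le> n \<and> full_column_rank n p V \<and>
     (\<forall>x\<in>carrier_vec n. mult_mat_vec (transpose_mat V) x = 0\<^sub>v p \<longrightarrow> 0 \<le> quad_form L x)"

definition point_process :: "nat \<Rightarrow> 'w measure \<Rightarrow> ('w \<Rightarrow> nat set) \<Rightarrow> bool" where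
  "point_process n M \<X> \<longleftrightarrow>
     prob_space M \<and> \<X> \<in> measurable M (count_space (Pow {..<n}))"

definition prob_eq :: "'w measure \<Rightarrow> ('w \<Rightarrow> nat set) \<Rightarrow> nat set \<Rightarrow> real" where
  "prob_eq M \<X> X = measure M {\<omega> \<in> space M. \<X> \<omega> = X}"

definition is_DPP ::
  "nat \<Rightarrow> real Matrix.mat \<Rightarrow> 'w measure \<Rightarrow> ('w \<Rightarrow> nat set) \<Rightarrow> bool" where
  "is_DPP n L M \<X> \<longleftrightarrow>
     pos_semidef n L \<and> point_process n M \<X> \<and>
     (\<forall>X\<subseteq>{..<n}. prob_eq M \<X> X =
        Determinant.det (submatrix L X X) / Determinant.det (1\<^sub>m n + L))"

definition bordered_matrix ::
  "nat \<Rightarrow> real Matrix.mat \<Rightarrow> real Matrix.mat \<Rightarrow> nat set \<Rightarrow> real Matrix.mat" where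
  "bordered_matrix p L V X =
     four_block_mat (submatrix L X X) (submatrix V X UNIV)
                    (transpose_mat (submatrix V X UNIV)) (0\<^sub>m p p)"

definition is_extended_DPP ::
  "nat \<Rightarrow> nat \<Rightarrow> real Matrix.mat \<Rightarrow> real Matrix.mat \<Rightarrow> 'w measure \<Rightarrow> ('w \<Rightarrow> nat set) \<Rightarrow> bool" where
  "is_extended_DPP n p L V M \<X> \<longleftrightarrow>
     nonneg_pair n p L V \<and> point_process n M \<X> \<and>
     (\<exists>c>0. \<forall>X\<subseteq>{..<n}. prob_eq M \<X> X =
        c * ((-1) ^ p * Determinant.det (bordered_matrix p L V X)))"

text \<open>The processes may live on different probability spaces; only their laws matter.\<close>

definition pp_converges ::
  "nat \<Rightarrow> (real \<Rightarrow> 'w measure) \<Rightarrow> (real \<Rightarrow> 'w \<Rightarrow> nat set) \<Rightarrow>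
     'v measure \<Rightarrow> ('v \<Rightarrow> nat set) \<Rightarrow> real filter \<Rightarrow> bool" where
  "pp_converges n M \<X> N \<Y> F \<longleftrightarrow>
     (\<forall>X\<subseteq>{..<n}. ((\<lambda>\<epsilon>. prob_eq (M \<epsilon>) (\<X> \<epsilon>) X) \<longlongrightarrow> prob_eq N \<Y> X) F)"

end

theory Submission
  imports Defs
begin

text \<open>
  The divergence of \<open>A + \<epsilon>\<inverse> V V\<^sup>T\<close> is removed by a Schur complement. For \<open>\<epsilon> \<noteq> 0\<close>, every square \<open>B\<close> and every
  matching \<open>W\<close> with \<open>p\<close> columns,
  \<open>\<epsilon>\<^sup>p det (B + \<epsilon>\<inverse> W W\<^sup>T)\<close> equals \<open>(-1)\<^sup>p\<close> times the determinant of the block matrix with rows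
  \<open>(B, W)\<close> and \<open>(W\<^sup>T, - \<epsilon> I)\<close>
  (\<open>det_add_outer_eq_det_bordered\<close>). The right-hand side is continuous in \<open>\<epsilon>\<close>, also at \<open>0\<close>, where the
  lower right block vanishes (\<open>scaled_det_tendsto_bordered\<close>).

  With \<open>B = A\<^sub>X\<close> and \<open>W = V\<^sub>X\<close> this gives the limit of the rescaled numerator of \<open>P(\<X>\<^sub>\<epsilon> = X)\<close>: exactly the
  weight of \<open>X\<close> in the extended L-ensemble. With \<open>B = I + A\<close> and \<open>W = V\<close> it gives the limit \<open>D\<close> of the
  rescaled normalising constant. The powers \<open>\<epsilon>\<^sup>p\<close> cancel in the quotient, so the probabilities
  converge as soon as \<open>D \<noteq> 0\<close>.

  That \<open>D\<close> is nonzero is a saddle point argument (\<open>bordered_det_nonzero\<close>): \<open>V\<close> is injective, and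
  \<open>I + A\<close> is definite on the kernel of \<open>V\<^sup>T\<close>, because there \<open>A\<close> has the same quadratic form as the
  positive semidefinite \<open>A + \<epsilon>\<inverse> V V\<^sup>T\<close>. Probabilities on a finite set that converge pointwise have a
  probability vector as their limit, and this vector is the law of the required process.
\<close>

section \<open>Determinants of bordered matrices\<close>

text \<open>
  The bordered matrix has the Schur complement \<open>B + e\<inverse> W W\<^sup>T\<close> with respect to its lower right block.
  The factor \<open>e ^ p\<close> comes from the determinant of that block; with it the right-hand side is a
  polynomial in \<open>e\<close>, so it survives the limit \<open>e \<rightarrow> 0\<close>.
\<close>

lemma det_add_outer_eq_det_bordered:
  fixes B W :: "real Matrix.mat"
  assumes B: "B \<in> carrier_mat m m" and W: "W \<in> carrier_mat m p" and e: "e \<noteq> 0"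
  shows "e ^ p * Determinant.det (B + inverse e \<cdot>\<^sub>m (W * transpose_mat W)) =
    (-1) ^ p * Determinant.det (four_block_mat B W (transpose_mat W) ((- e) \<cdot>\<^sub>m 1\<^sub>m p))"
proof -
  let ?Wt = "transpose_mat W" and ?D = "(- e) \<cdot>\<^sub>m (1\<^sub>m p :: real mat)"
  let ?K = "four_block_mat B W ?Wt ?D"
  \<comment> \<open>The unimodular factor that clears the lower left block by column operations.\<close>
  let ?E = "four_block_mat (1\<^sub>m m) (0\<^sub>m m p) (inverse e \<cdot>\<^sub>m ?Wt) (1\<^sub>m p)"
  let ?S = "B + inverse e \<cdot>\<^sub>m (W * ?Wt)"
  have K: "?K \<in> carrier_mat (m + p) (m + p)" and E: "?E \<in> carrier_mat (m + p) (m + p)"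
    using B by auto
  have WW: "W * (inverse e \<cdot>\<^sub>m ?Wt) = inverse e \<cdot>\<^sub>m (W * ?Wt)"
    using W by (intro mult_smult_distrib) auto
  have "?D * (inverse e \<cdot>\<^sub>m ?Wt) = (- e) \<cdot>\<^sub>m (1\<^sub>m p * (inverse e \<cdot>\<^sub>m ?Wt))"
    using W by (intro mult_smult_assoc_mat) auto
  then have "?D * (inverse e \<cdot>\<^sub>m ?Wt) = - ?Wt"
    using W e by (intro eq_matI) auto
  then have DW: "?Wt + ?D * (inverse e \<cdot>\<^sub>m ?Wt) = 0\<^sub>m p m"
    using W by auto
  have "?K * ?E = four_block_mat (B * 1\<^sub>m m + W * (inverse e \<cdot>\<^sub>m ?Wt)) (B * 0\<^sub>m m p + W * 1\<^sub>m p)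
      (?Wt * 1\<^sub>m m + ?D * (inverse e \<cdot>\<^sub>m ?Wt)) (?Wt * 0\<^sub>m m p + ?D * 1\<^sub>m p)"
    by (rule mult_four_block_mat[where ?nr1.0 = m and ?n1.0 = m and ?n2.0 = p and ?nr2.0 = p
          and ?nc1.0 = m and ?nc2.0 = p]) (use B W in auto)
  also have "\<dots> = four_block_mat ?S W (0\<^sub>m p m) ?D"
    using B W WW DW by simp
  finally have KE: "?K * ?E = four_block_mat ?S W (0\<^sub>m p m) ?D" .
  have "Determinant.det ?E = 1"
    using W by (subst det_four_block_mat_upper_right_zero[of _ m _ p]) auto
  then have "Determinant.det ?K = Determinant.det (?K * ?E)"
    using det_mult[OF K E] by simp
  also have "\<dots> = Determinant.det ?S * (- e) ^ p"
    unfolding KE using B W by (subst det_four_block_mat_lower_left_zero[of _ m _ p]) auto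
  finally have "Determinant.det ?K = Determinant.det ?S * (- e) ^ p" .
  moreover have "(-1) ^ p * (- e) ^ p = e ^ p"
    by (simp flip: power_mult_distrib)
  ultimately show ?thesis by (simp add: ac_simps)
qed

lemma tendsto_det:
  fixes f :: "'a \<Rightarrow> 'b :: {real_normed_algebra, comm_ring_1} Matrix.mat"
  assumes "\<And>x. f x \<in> carrier_mat n n" "L \<in> carrier_mat n n"
    and "\<And>i j. i < n \<Longrightarrow> j < n \<Longrightarrow> ((\<lambda>x. f x $$ (i, j)) \<longlongrightarrow> L $$ (i, j)) F"
  shows "((\<lambda>x. Determinant.det (f x)) \<longlongrightarrow> Determinant.det L) F"
proof -
  have "p i < n" if "p permutes {0..<n}" "i < n" for p :: "nat \<Rightarrow> nat" and i
    using that permutes_in_image[of p "{0..<n}" i] by simp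
  then show ?thesis
    unfolding det_def'[OF assms(1)] det_def'[OF assms(2)]
    by (intro tendsto_sum tendsto_mult tendsto_const tendsto_prod assms(3)) auto
qed

lemma scaled_det_tendsto_bordered:
  fixes B W :: "real Matrix.mat"
  assumes B: "B \<in> carrier_mat m m" and W: "W \<in> carrier_mat m p"
  shows "((\<lambda>e. e ^ p * Determinant.det (B + inverse e \<cdot>\<^sub>m (W * transpose_mat W))) \<longlongrightarrow>
    (-1) ^ p * Determinant.det (four_block_mat B W (transpose_mat W) (0\<^sub>m p p))) (at_right 0)"
proof -
  let ?K = "\<lambda>e. four_block_mat B W (transpose_mat W) ((- e) \<cdot>\<^sub>m 1\<^sub>m p)"
  have "((\<lambda>e. Determinant.det (?K e)) \<longlongrightarrow>
      Determinant.det (four_block_mat B W (transpose_mat W) (0\<^sub>m p p))) (at_right 0)"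
  proof (rule tendsto_det[where n = "m + p"])
    fix i j assume ij: "i < m + p" "j < m + p"
    have entry: "?K e $$ (i, j) = four_block_mat B W (transpose_mat W) (0\<^sub>m p p) $$ (i, j) +
        e * (if m \<le> i \<and> i = j then - 1 else 0)" for e
      using B W ij by (cases "i < m"; cases "j < m") auto
    show "((\<lambda>e. ?K e $$ (i, j)) \<longlongrightarrow>
        four_block_mat B W (transpose_mat W) (0\<^sub>m p p) $$ (i, j)) (at_right 0)"
      unfolding entry by (rule tendsto_eq_intros tendsto_mult_left_zero refl | simp)+
  qed (use B in auto)
  then have "((\<lambda>e. (-1) ^ p * Determinant.det (?K e)) \<longlongrightarrow>
      (-1) ^ p * Determinant.det (four_block_mat B W (transpose_mat W) (0\<^sub>m p p))) (at_right 0)"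
    by (rule tendsto_mult_left)
  moreover have "\<forall>\<^sub>F e in at_right 0. (-1) ^ p * Determinant.det (?K e) =
      e ^ p * Determinant.det (B + inverse e \<cdot>\<^sub>m (W * transpose_mat W))"
    using eventually_at_right_less[of 0]
    by eventually_elim (simp add: det_add_outer_eq_det_bordered[OF B W])
  ultimately show ?thesis
    by (rule Lim_transform_eventually)
qed

text \<open>
  A kernel vector \<open>(x, y)\<close> satisfies \<open>B x + W y = 0\<close> and \<open>W\<^sup>T x = 0\<close>. Pairing the first equation with \<open>x\<close>
  kills the term with \<open>y\<close> by the second one, so \<open>x\<close> is isotropic for \<open>B\<close>, hence \<open>x = 0\<close>; then
  \<open>W y = 0\<close>, hence \<open>y = 0\<close>.
\<close>

lemma bordered_det_nonzero:
  fixes B W :: "real Matrix.mat"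
  assumes B: "B \<in> carrier_mat n n" and W: "W \<in> carrier_mat n p"
    and inj: "\<And>y. y \<in> carrier_vec p \<Longrightarrow> W *\<^sub>v y = 0\<^sub>v n \<Longrightarrow> y = 0\<^sub>v p"
    and definite: "\<And>x. x \<in> carrier_vec n \<Longrightarrow> transpose_mat W *\<^sub>v x = 0\<^sub>v p \<Longrightarrow>
      quad_form B x = 0 \<Longrightarrow> x = 0\<^sub>v n"
  shows "Determinant.det (four_block_mat B W (transpose_mat W) (0\<^sub>m p p)) \<noteq> 0"
proof
  let ?Wt = "transpose_mat W"
  let ?K = "four_block_mat B W ?Wt (0\<^sub>m p p)"
  have K: "?K \<in> carrier_mat (n + p) (n + p)" using B by auto
  assume "Determinant.det ?K = 0"
  then obtain v where v: "v \<in> carrier_vec (n + p)" "v \<noteq> 0\<^sub>v (n + p)" "?K *\<^sub>v v = 0\<^sub>v (n + p)"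
    using det_0_iff_vec_prod_zero[OF K] by auto
  define x where "x = vec_first v n"
  define y where "y = vec_last v p"
  have x: "x \<in> carrier_vec n" and y: "y \<in> carrier_vec p" and vxy: "v = x @\<^sub>v y"
    using v(1) by (simp_all add: x_def y_def)
  have zero: "(0\<^sub>v (n + p) :: real vec) = 0\<^sub>v n @\<^sub>v 0\<^sub>v p" by auto
  have "?K *\<^sub>v v = (B *\<^sub>v x + W *\<^sub>v y) @\<^sub>v (?Wt *\<^sub>v x + 0\<^sub>m p p *\<^sub>v y)"
    unfolding vxy by (rule four_block_mat_mult_vec[OF B W _ _ x y]) (use W in auto)
  then have "(B *\<^sub>v x + W *\<^sub>v y) @\<^sub>v (?Wt *\<^sub>v x + 0\<^sub>m p p *\<^sub>v y) = 0\<^sub>v n @\<^sub>v 0\<^sub>v p"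
    using v(3) zero by simp
  then have top: "B *\<^sub>v x + W *\<^sub>v y = 0\<^sub>v n" and "?Wt *\<^sub>v x + 0\<^sub>m p p *\<^sub>v y = 0\<^sub>v p"
    using append_vec_eq[of "B *\<^sub>v x + W *\<^sub>v y" n "0\<^sub>v n"] B W x y by auto
  moreover have "0\<^sub>m p p *\<^sub>v y = 0\<^sub>v p" using y by (intro eq_vecI) auto
  ultimately have bot: "?Wt *\<^sub>v x = 0\<^sub>v p" using W x by simp
  have "x \<bullet> (W *\<^sub>v y) = (?Wt *\<^sub>v x) \<bullet> y"
    using transpose_vec_mult_scalar[OF W y x] by simp
  then have xWy: "x \<bullet> (W *\<^sub>v y) = 0" using bot y by simp
  have "x \<bullet> (B *\<^sub>v x + W *\<^sub>v y) = x \<bullet> (B *\<^sub>v x) + x \<bullet> (W *\<^sub>v y)"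
    using B W x y by (intro scalar_prod_add_distrib[of _ n]) auto
  then have "quad_form B x = 0"
    using xWy top x by (simp add: quad_form_def)
  then have x0: "x = 0\<^sub>v n" using definite x bot by blast
  have "B *\<^sub>v 0\<^sub>v n = 0\<^sub>v n" using B by (intro eq_vecI) auto
  then have "W *\<^sub>v y = 0\<^sub>v n" using top x0 W y by simp
  then have "y = 0\<^sub>v p" using inj y by blast
  then show False using v(2) vxy x0 zero by simp
qed

section \<open>Full column rank and submatrices\<close>

text \<open>
  The rank is the dimension of the span of the set of columns, and a set forgets repetitions. A rank
  equal to the number of columns therefore first forces the columns to be distinct; only then does
  linear independence of that set say that the matrix has trivial kernel.
\<close>

lemma full_column_rank_inj:
  assumes "full_column_rank n p V" and y: "y \<in> carrier_vec p" and Vy: "V *\<^sub>v y = 0\<^sub>v n"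
  shows "y = 0\<^sub>v p"
proof (rule ccontr)
  assume ne: "y \<noteq> 0\<^sub>v p"
  have V: "V \<in> carrier_mat n p" and r: "vec_space.rank n V = p"
    using assms(1) by (auto simp: full_column_rank_def)
  interpret vec_space "TYPE(real)" n .
  obtain S where S: "maximal S (\<lambda>T. T \<subseteq> set (cols V) \<and> lin_indpt T)"
    using maximal_exists[of "(\<lambda>T. T \<subseteq> set (cols V) \<and> lin_indpt T)" "card (set (cols V))" "{}"]
    by (meson List.finite_set card_mono empty_iff empty_subsetI finite_lin_indpt2 rev_finite_subset)
  then have "card S \<le> card (set (cols V))" by (simp add: card_mono maximal_def)
  then have "length (cols V) \<le> card (set (cols V))"
    using rank_card_indpt[OF V S] r V by simp
  then have d: "distinct (cols V)"
    using card_length[of "cols V"] by (intro card_distinct) simp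
  show False
    using full_rank_lin_indpt[OF V r d] lin_depI[OF V y ne Vy d] by blast
qed

lemma submatrix_add_smult_gram:
  fixes A V :: "real Matrix.mat"
  assumes A: "A \<in> carrier_mat n n" and V: "V \<in> carrier_mat n p"
  shows "submatrix (A + c \<cdot>\<^sub>m (V * transpose_mat V)) X X =
    submatrix A X X + c \<cdot>\<^sub>m (submatrix V X UNIV * transpose_mat (submatrix V X UNIV))"
  using A V pick_le[of _ n X]
  by (intro eq_matI) (auto simp: submatrix_def scalar_prod_def pick_UNIV)

text \<open>
  This transfers positive semidefiniteness of the perturbed matrix for a single \<open>c\<close> to
  nonnegativity of the quadratic form of \<open>A\<close> on the kernel of \<open>V\<^sup>T\<close>.
\<close>

lemma quad_form_add_smult_gram_kernel:
  fixes A V :: "real Matrix.mat"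
  assumes A: "A \<in> carrier_mat n n" and V: "V \<in> carrier_mat n p" and x: "x \<in> carrier_vec n"
    and ker: "transpose_mat V *\<^sub>v x = 0\<^sub>v p"
  shows "quad_form (A + c \<cdot>\<^sub>m (V * transpose_mat V)) x = quad_form A x"
proof -
  have "(V * transpose_mat V) *\<^sub>v x = V *\<^sub>v (transpose_mat V *\<^sub>v x)"
    using V x by (intro assoc_mult_mat_vec) auto
  also have "\<dots> = 0\<^sub>v n" unfolding ker using V by (intro eq_vecI) auto
  finally have "(V * transpose_mat V) *\<^sub>v x = 0\<^sub>v n" .
  moreover have "(c \<cdot>\<^sub>m K) *\<^sub>v x = c \<cdot>\<^sub>v (K *\<^sub>v x)" if "K \<in> carrier_mat n n" for K
    using that x by (intro eq_vecI) auto
  moreover have "c \<cdot>\<^sub>v 0\<^sub>v n = 0\<^sub>v n" by (intro eq_vecI) auto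
  ultimately have "(c \<cdot>\<^sub>m (V * transpose_mat V)) *\<^sub>v x = 0\<^sub>v n" using V by simp
  then have "(A + c \<cdot>\<^sub>m (V * transpose_mat V)) *\<^sub>v x = A *\<^sub>v x"
    using A V x by (simp add: add_mult_distrib_mat_vec[of _ n n])
  then show ?thesis by (simp add: quad_form_def)
qed

lemma quad_form_one_add:
  assumes B: "B \<in> carrier_mat n n" and x: "x \<in> carrier_vec n"
  shows "quad_form (1\<^sub>m n + B) x = x \<bullet> x + quad_form B x"
  using B x by (simp add: quad_form_def add_mult_distrib_mat_vec[of _ n n]
      scalar_prod_add_distrib[of _ n])

section \<open>Laws of point processes\<close>

lemma sum_prob_eq:
  assumes "point_process n M \<X>"
  shows "(\<Sum>X\<in>Pow {..<n}. prob_eq M \<X> X) = 1"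
proof -
  interpret prob_space M using assms by (simp add: point_process_def)
  have meas: "\<X> \<in> measurable M (count_space (Pow {..<n}))"
    using assms by (simp add: point_process_def)
  have eq: "{\<omega> \<in> space M. \<X> \<omega> = X} = \<X> -` {X} \<inter> space M" for X by auto
  have "1 = prob (\<Union>X\<in>Pow {..<n}. {\<omega> \<in> space M. \<X> \<omega> = X})"
    using measurable_space[OF meas] by (subst prob_space[symmetric]) (auto intro!: arg_cong[of _ _ prob])
  also have "\<dots> = (\<Sum>X\<in>Pow {..<n}. prob {\<omega> \<in> space M. \<X> \<omega> = X})"
    using measurable_sets[OF meas]
    by (intro finite_measure_finite_Union) (auto simp: disjoint_family_on_def eq)
  finally show ?thesis by (simp add: prob_eq_def)
qed

lemma ex_point_process_with_law:
  assumes "\<And>X. X \<subseteq> {..<n} \<Longrightarrow> 0 \<le> f X" and "(\<Sum>X\<in>Pow {..<n}. f X) = 1"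
  shows "\<exists>(N :: nat set measure) \<Y>. point_process n N \<Y> \<and> (\<forall>X\<subseteq>{..<n}. prob_eq N \<Y> X = f X)"
proof (intro exI conjI allI impI)
  let ?N = "point_measure (Pow {..<n}) f"
  have "emeasure ?N (space ?N) = 1"
    using assms sum_ennreal[of "Pow {..<n}" f]
    by (simp add: space_point_measure emeasure_point_measure_finite)
  then show "point_process n ?N (\<lambda>X. X)"
    by (simp add: point_process_def prob_space.intro prob_spaceI space_point_measure)
  fix X assume X: "X \<subseteq> {..<n}"
  then have "{Y \<in> space ?N. Y = X} = {X}" by (auto simp: space_point_measure)
  then show "prob_eq ?N (\<lambda>X. X) X = f X"
    using X assms(1) measure_point_measure_finite_if[of "Pow {..<n}" f "{X}"]
    by (simp add: prob_eq_def)
qed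

section \<open>The limit process\<close>

theorem proposition4p3:
  fixes n p :: nat
    and A V :: "real Matrix.mat"
    and M :: "real \<Rightarrow> 'w measure"
    and \<X> :: "real \<Rightarrow> 'w \<Rightarrow> nat set"
  assumes "p < n"
    and "full_column_rank n p V"
    and "symmetric_matrix n A"
    and "vec_space.rank n A = n"
    and "\<forall>\<^sub>F \<epsilon> in at_right 0. pos_semidef n (A + inverse \<epsilon> \<cdot>\<^sub>m (V * transpose_mat V))"
    and "\<forall>\<^sub>F \<epsilon> in at_right 0. is_DPP n (A + inverse \<epsilon> \<cdot>\<^sub>m (V * transpose_mat V)) (M \<epsilon>) (\<X> \<epsilon>)"
  shows "\<exists>(N :: nat set measure) \<Y>.
           is_extended_DPP n p A V N \<Y> \<and> pp_converges n M \<X> N \<Y> (at_right 0)"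
proof -
  let ?L = "\<lambda>e. A + inverse e \<cdot>\<^sub>m (V * transpose_mat V)"
  have A: "A \<in> carrier_mat n n" and V: "V \<in> carrier_mat n p"
    using assms(2,3) by (auto simp: symmetric_matrix_def full_column_rank_def)
  have nonneg: "0 \<le> quad_form A x"
    if x: "x \<in> carrier_vec n" "transpose_mat V *\<^sub>v x = 0\<^sub>v p" for x
  proof -
    obtain e where "pos_semidef n (?L e)"
      using eventually_happens'[OF _ assms(5)] by auto
    then show ?thesis
      using x quad_form_add_smult_gram_kernel[OF A V x] by (auto simp: pos_semidef_def)
  qed
  \<comment> \<open>The limits, after rescaling by \<open>e ^ p\<close>, of the normalising constant and of the weight of \<open>X\<close>.\<close>
  define D where "D = (-1) ^ p * Determinant.det (four_block_mat (1\<^sub>m n + A) V (transpose_mat V) (0\<^sub>m p p))"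
  define g where "g X = (-1) ^ p * Determinant.det (bordered_matrix p A V X)" for X
  have den: "((\<lambda>e. e ^ p * Determinant.det (1\<^sub>m n + ?L e)) \<longlongrightarrow> D) (at_right 0)"
  proof -
    have "(1\<^sub>m n + A) + inverse e \<cdot>\<^sub>m (V * transpose_mat V) = 1\<^sub>m n + ?L e" for e
      using A V by (intro assoc_add_mat) auto
    then show ?thesis
      using scaled_det_tendsto_bordered[of "1\<^sub>m n + A" n V p] A V by (simp add: D_def)
  qed
  have num: "((\<lambda>e. e ^ p * Determinant.det (submatrix (?L e) X X)) \<longlongrightarrow> g X) (at_right 0)" for X
    unfolding submatrix_add_smult_gram[OF A V] g_def bordered_matrix_def
    by (rule scaled_det_tendsto_bordered[where m = "card {i. i < n \<and> i \<in> X}"])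
      (use A V in \<open>auto simp: submatrix_def\<close>)
  have "D \<noteq> 0"
  proof -
    have "x = 0\<^sub>v n" if x: "x \<in> carrier_vec n" "transpose_mat V *\<^sub>v x = 0\<^sub>v p"
      and "quad_form (1\<^sub>m n + A) x = 0" for x
    proof -
      have "x \<bullet> x \<le> 0"
        using nonneg[OF x] that(3) quad_form_one_add[OF A x(1)] by simp
      moreover have "0 \<le> x \<bullet> x" by (simp add: scalar_prod_def sum_nonneg)
      ultimately have "x \<bullet> x = 0" by simp
      then show ?thesis
        using x(1) by (intro eq_vecI) (auto simp: scalar_prod_def sum_nonneg_eq_0_iff)
    qed
    then have "Determinant.det (four_block_mat (1\<^sub>m n + A) V (transpose_mat V) (0\<^sub>m p p)) \<noteq> 0"
      using A by (intro bordered_det_nonzero[OF _ V full_column_rank_inj[OF assms(2)]]) auto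
    then show ?thesis by (simp add: D_def)
  qed
  moreover have "0 \<le> D"
  proof (rule tendsto_lowerbound[OF den])
    show "\<forall>\<^sub>F e in at_right 0. 0 \<le> e ^ p * Determinant.det (1\<^sub>m n + ?L e)"
      using assms(6) eventually_at_right_less[of 0]
    proof eventually_elim
      case (elim e)
      \<comment> \<open>The empty minor is 1, so the probability of the empty set exhibits the sign of the
        normalising constant.\<close>
      have "prob_eq (M e) (\<X> e) {} = 1 / Determinant.det (1\<^sub>m n + ?L e)"
        using elim(1) by (simp add: is_DPP_def submatrix_def)
      moreover have "0 \<le> prob_eq (M e) (\<X> e) {}"
        by (simp add: prob_eq_def)
      ultimately show ?case using elim(2) by simp
    qed
  qed simp
  ultimately have D: "0 < D" by simp
  have lim: "((\<lambda>e. prob_eq (M e) (\<X> e) X) \<longlongrightarrow> g X / D) (at_right 0)" if X: "X \<subseteq> {..<n}" for X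
  proof (rule Lim_transform_eventually[OF tendsto_divide[OF num den \<open>D \<noteq> 0\<close>]])
    show "\<forall>\<^sub>F e in at_right 0. e ^ p * Determinant.det (submatrix (?L e) X X) /
        (e ^ p * Determinant.det (1\<^sub>m n + ?L e)) = prob_eq (M e) (\<X> e) X"
      using assms(6) eventually_at_right_less[of 0]
      by eventually_elim (use X in \<open>simp add: is_DPP_def\<close>)
  qed
  have "0 \<le> g X / D" if "X \<subseteq> {..<n}" for X
    by (rule tendsto_lowerbound[OF lim[OF that]]) (simp_all add: prob_eq_def)
  moreover have "(\<Sum>X\<in>Pow {..<n}. g X / D) = 1"
  proof (rule tendsto_unique)
    show "((\<lambda>e. \<Sum>X\<in>Pow {..<n}. prob_eq (M e) (\<X> e) X) \<longlongrightarrow> (\<Sum>X\<in>Pow {..<n}. g X / D)) (at_right 0)"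
      by (intro tendsto_sum lim) auto
    have "\<forall>\<^sub>F e in at_right 0. 1 = (\<Sum>X\<in>Pow {..<n}. prob_eq (M e) (\<X> e) X)"
      using assms(6) by eventually_elim (metis is_DPP_def sum_prob_eq)
    then show "((\<lambda>e. \<Sum>X\<in>Pow {..<n}. prob_eq (M e) (\<X> e) X) \<longlongrightarrow> 1) (at_right 0)"
      by (rule Lim_transform_eventually[OF tendsto_const])
  qed simp
  ultimately obtain N :: "nat set measure" and \<Y> where N: "point_process n N \<Y>"
    and law: "\<forall>X\<subseteq>{..<n}. prob_eq N \<Y> X = g X / D"
    using ex_point_process_with_law[of n "\<lambda>X. g X / D"] by blast
  have "nonneg_pair n p A V"
    using assms(1-3) nonneg by (simp add: nonneg_pair_def)
  moreover have "\<exists>c>0. \<forall>X\<subseteq>{..<n}. prob_eq N \<Y> X = c * g X"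
    using law D by (intro exI[of _ "1 / D"]) simp
  ultimately have "is_extended_DPP n p A V N \<Y>"
    using N by (simp add: is_extended_DPP_def g_def)
  moreover have "pp_converges n M \<X> N \<Y> (at_right 0)"
    using lim law by (simp add: pp_converges_def)
  ultimately show ?thesis by blast
qed

end
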